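(* Let $D$ be a ring with $\mathbb Z\subseteq D\subseteq \mathbb Q$ and let $d\ge 2$. In the Coefficient-Choosing Game with parameters $D$ and $d$, the player who makes the last play has a winning strategy.
   Context: The Coefficient-Choosing Game with parameters an integral domain $D$ and a degree $d\ge 2$: one of two players, Wanda or Nora, is designated Player I and the other Player II. Starting with Player I, the players alternately choose the coefficients $a_0,\dots,a_d\in D$ of a polynomial $f(x)=a_dx^d+\cdots+a_1x+a_0$; on each turn the player picks any not-yet-chosen index $i$ (the order is not predetermined) and a value $a_i\in D$, subject to the rule that $a_d\neq 0$ and $a_0\neq 0$. When all $d+1$ coefficients are chosen, Wanda wins if $f$ has a root in the field of fractions of $D$, and Nora wins otherwise. "A player wins" means that player has a strategy that wins no matter how the other plays. *)

theory Defs
  imports "HOL-Computational_Algebra.Polynomial"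
begin

text \<open>An integral domain is represented as a subring \<open>D\<close> (with the same unit) of an ambient
  field, so that its field of fractions is the set of quotients of elements of \<open>D\<close>.\<close>

definition is_subring :: "'a::field set \<Rightarrow> bool" where
  "is_subring D \<longleftrightarrow> 0 \<in> D \<and> 1 \<in> D \<and> (\<forall>x\<in>D. - x \<in> D) \<and>
     (\<forall>x\<in>D. \<forall>y\<in>D. x + y \<in> D) \<and> (\<forall>x\<in>D. \<forall>y\<in>D. x * y \<in> D)"

definition fraction_field :: "'a::field set \<Rightarrow> 'a set" where
  "fraction_field D = {a / b | a b. a \<in> D \<and> b \<in> D \<and> b \<noteq> 0}"

datatype player = Wanda | Nora

fun opponent :: "player \<Rightarrow> player" where
  "opponent Wanda = Nora"
| "opponent Nora = Wanda"

text \<open>The move \<open>(i, a)\<close> sets the coefficient of \<open>x ^ i\<close> to \<open>a\<close>. A position is the chronological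
  list of the moves made so far.\<close>

type_synonym 'a move = "nat \<times> 'a"
type_synonym 'a position = "'a move list"

definition legal_move :: "'a::field set \<Rightarrow> nat \<Rightarrow> 'a position \<Rightarrow> 'a move \<Rightarrow> bool" where
  "legal_move D d h m \<longleftrightarrow> (case m of (i, a) \<Rightarrow>
     i \<le> d \<and> i \<notin> fst ` set h \<and> a \<in> D \<and> (i = 0 \<or> i = d \<longrightarrow> a \<noteq> 0))"

definition legal_position :: "'a::field set \<Rightarrow> nat \<Rightarrow> 'a position \<Rightarrow> bool" where
  "legal_position D d h \<longleftrightarrow> (\<forall>n<length h. legal_move D d (take n h) (h ! n))"

definition complete_play :: "'a::field set \<Rightarrow> nat \<Rightarrow> 'a position \<Rightarrow> bool" where
  "complete_play D d h \<longleftrightarrow> legal_position D d h \<and> length h = d + 1"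

text \<open>The player who makes move number \<open>n\<close>, counted from 0, when \<open>pI\<close> is Player I.\<close>

definition mover :: "player \<Rightarrow> nat \<Rightarrow> player" where
  "mover pI n = (if even n then pI else opponent pI)"

text \<open>The moves are numbered \<open>0, \<dots>, d\<close>.\<close>

definition last_player :: "player \<Rightarrow> nat \<Rightarrow> player" where
  "last_player pI d = mover pI d"

definition play_poly :: "'a::field position \<Rightarrow> 'a poly" where
  "play_poly h = (\<Sum>(i, a)\<leftarrow>h. monom a i)"

fun wins_play :: "'a::field set \<Rightarrow> 'a position \<Rightarrow> player \<Rightarrow> bool" where
  "wins_play D h Wanda \<longleftrightarrow> (\<exists>x\<in>fraction_field D. poly (play_poly h) x = 0)"
| "wins_play D h Nora \<longleftrightarrow> \<not> (\<exists>x\<in>fraction_field D. poly (play_poly h) x = 0)"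

text \<open>A strategy must prescribe a legal move at every unfinished legal position in which its owner
  is to move; otherwise an illegal strategy would win vacuously.\<close>

definition strategy ::
  "'a::field set \<Rightarrow> nat \<Rightarrow> player \<Rightarrow> player \<Rightarrow> ('a position \<Rightarrow> 'a move) \<Rightarrow> bool" where
  "strategy D d pI p \<sigma> \<longleftrightarrow>
     (\<forall>h. legal_position D d h \<and> length h < d + 1 \<and> mover pI (length h) = p
        \<longrightarrow> legal_move D d h (\<sigma> h))"

definition follows :: "player \<Rightarrow> player \<Rightarrow> ('a position \<Rightarrow> 'a move) \<Rightarrow> 'a position \<Rightarrow> bool" where
  "follows pI p \<sigma> h \<longleftrightarrow> (\<forall>n<length h. mover pI n = p \<longrightarrow> h ! n = \<sigma> (take n h))"

definition has_winning_strategy :: "'a::field set \<Rightarrow> nat \<Rightarrow> player \<Rightarrow> player \<Rightarrow> bool" where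
  "has_winning_strategy D d pI p \<longleftrightarrow>
     (\<exists>\<sigma>. strategy D d pI p \<sigma> \<and>
        (\<forall>h. complete_play D d h \<and> follows pI p \<sigma> h \<longrightarrow> wins_play D h p))"

end

(* Whoever moves last wins whatever happened before. With one coefficient left, Wanda
  forces the root 1 if that coefficient is an inner one, and otherwise a root n or 1/n for an
  integer n avoiding finitely many values. Nora fills the gap with a prime p: by the rational
  root test the possible roots are y, p * y or y / p with y in a finite set independent of p, and
  for each y the root condition is a nonzero polynomial condition on p, so almost all p work. *)
theory Submission
  imports Defs "HOL-Computational_Algebra.Primes"
begin

section \<open>Clearing denominators and the rational root test\<close>

lemma common_denominator:
  fixes c :: "nat \<Rightarrow> rat"
  shows "\<exists>N::int. N > 0 \<and> (\<exists>b. \<forall>k\<le>d. of_int N * c k = of_int (b k))"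
proof (induction d)
  case 0
  obtain u v where "v > 0" "c 0 = of_int u / of_int v"
    by (metis Fract_of_int_quotient Rat_cases)
  then show ?case by (intro exI[of _ v] conjI exI[of _ "\<lambda>_. u"]) auto
next
  case (Suc d)
  then obtain N b where N: "N > 0" and b: "\<forall>k\<le>d. of_int N * c k = of_int (b k)" by blast
  obtain u v where uv: "v > 0" "c (Suc d) = of_int u / of_int v"
    by (metis Fract_of_int_quotient Rat_cases)
  have "of_int (v * N) * c k = of_int (if k \<le> d then v * b k else N * u)" if "k \<le> Suc d" for k
  proof (cases "k \<le> d")
    case True
    then show ?thesis using b by (simp add: mult.assoc)
  next
    case False
    then have "k = Suc d" using that by simp
    then show ?thesis using uv by simp
  qed
  moreover have "v * N > 0" using N uv by simp
  ultimately show ?case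
    by (intro exI[of _ "v * N"] conjI exI[of _ "\<lambda>k. if k \<le> d then v * b k else N * u"]) blast+
qed

text \<open>Every summand with \<open>k > 0\<close> contains a factor \<open>r\<close>, so
  \<open>r\<close> divides the remaining one, \<open>b 0 * s ^ d\<close>, and coprimality removes
  the power of \<open>s\<close>.\<close>

lemma homogeneous_root_dvd_first:
  fixes b :: "nat \<Rightarrow> int"
  assumes "coprime r s" and "(\<Sum>k\<le>d. b k * r ^ k * s ^ (d - k)) = 0"
  shows "r dvd b 0"
proof -
  have "(\<Sum>k\<le>d. b k * r ^ k * s ^ (d - k)) =
      b 0 * s ^ d + (\<Sum>k\<in>{..d} - {0}. b k * r ^ k * s ^ (d - k))"
    by (subst sum.remove[of _ 0]) auto
  moreover have "r dvd (\<Sum>k\<in>{..d} - {0}. b k * r ^ k * s ^ (d - k))"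
    by (intro dvd_sum dvd_mult2 dvd_mult) (auto simp: dvd_power)
  ultimately have "r dvd b 0 * s ^ d"
    using assms(2) by (metis dvd_0_right dvd_add_left_iff)
  then show ?thesis
    using assms(1) by (simp add: coprime_dvd_mult_left_iff)
qed

lemma sum_atMost_reverse: "(\<Sum>k\<le>d. f (d - k) k) = (\<Sum>k\<le>(d::nat). f k (d - k))"
  by (rule sum.reindex_bij_witness[of _ "\<lambda>k. d - k" "\<lambda>k. d - k"]) auto

text \<open>Reversing the coefficient sequence swaps the roles of \<open>r\<close> and
  \<open>s\<close>, which reduces this to the divisibility of the first coefficient.\<close>

lemma homogeneous_root_dvd_last:
  fixes b :: "nat \<Rightarrow> int"
  assumes "coprime r s" and "(\<Sum>k\<le>d. b k * r ^ k * s ^ (d - k)) = 0"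
  shows "s dvd b d"
proof -
  have "(\<Sum>k\<le>d. b (d - k) * s ^ k * r ^ (d - k)) = (\<Sum>k\<le>d. b k * s ^ (d - k) * r ^ k)"
    by (rule sum_atMost_reverse[of "\<lambda>j k. b j * s ^ k * r ^ j"])
  also have "\<dots> = 0" using assms(2) by (simp add: mult_ac)
  finally show ?thesis
    using homogeneous_root_dvd_first[of s r "\<lambda>k. b (d - k)" d] assms(1)
    by (simp add: coprime_commute)
qed

lemma rational_root_dvd:
  fixes c :: "nat \<Rightarrow> rat" and b :: "nat \<Rightarrow> int"
  assumes cop: "coprime r s" and s: "s \<noteq> 0"
    and b: "\<And>k. k \<le> d \<Longrightarrow> of_int N * c k = of_int (b k)"
    and root: "(\<Sum>k\<le>d. c k * (of_int r / of_int s) ^ k) = 0"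
  shows "r dvd b 0" and "s dvd b d"
proof -
  \<comment> \<open>Multiplying the root equation by \<open>N * s ^ d\<close> gives a homogeneous
    equation over the integers: \<open>N\<close> clears the coefficients, \<open>s ^ d\<close> the
    powers of the root.\<close>
  have "of_int (\<Sum>k\<le>d. b k * r ^ k * s ^ (d - k)) =
      (\<Sum>k\<le>d. of_int N * of_int s ^ d * (c k * (of_int r / of_int s) ^ k))"
    unfolding of_int_sum
  proof (rule sum.cong[OF refl])
    fix k assume "k \<in> {..d}"
    then have k: "k \<le> d" by simp
    have "(of_int s :: rat) ^ d = of_int s ^ (d - k) * of_int s ^ k"
      using k by (simp flip: power_add)
    then show "of_int (b k * r ^ k * s ^ (d - k)) =
        of_int N * of_int s ^ d * (c k * (of_int r / of_int s) ^ k)"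
      using b[OF k, symmetric] s by (simp add: power_divide)
  qed
  also have "\<dots> = of_int N * of_int s ^ d * 0"
    by (simp only: root flip: sum_distrib_left)
  finally have "(\<Sum>k\<le>d. b k * r ^ k * s ^ (d - k)) = 0"
    by (simp only: mult_zero_right of_int_eq_0_iff)
  then show "r dvd b 0" and "s dvd b d"
    using homogeneous_root_dvd_first homogeneous_root_dvd_last cop by blast+
qed

section \<open>Nora's last move: avoiding finitely many values\<close>

lemma finite_nat_roots:
  fixes P :: "'a::{idom, ring_char_0} poly"
  assumes "P \<noteq> 0"
  shows "finite {n::nat. poly P (of_nat n) = 0}"
proof -
  have "finite (of_nat -` {x. poly P x = 0} :: nat set)"
    by (intro finite_vimageI poly_roots_finite assms inj_of_nat)
  then show ?thesis by (simp add: vimage_def)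
qed

text \<open>For fixed \<open>y\<close> the sum is linear in \<open>p\<close>, with slope
  \<open>y ^ i\<close>, which is nonzero.\<close>

lemma finite_constant_at_fixed_root:
  fixes c :: "nat \<Rightarrow> rat"
  assumes "i \<le> d" and "y \<noteq> 0"
  shows "finite {p::nat. (\<Sum>k\<le>d. (c(i := of_nat p)) k * y ^ k) = 0}"
proof -
  let ?P = "[:\<Sum>k\<in>{..d} - {i}. c k * y ^ k, y ^ i:]"
  have "(\<Sum>k\<le>d. (c(i := of_nat p)) k * y ^ k) = poly ?P (of_nat p)" for p
    using assms(1) by (subst sum.remove[of _ i]) (auto simp: algebra_simps intro!: sum.cong)
  moreover have "?P \<noteq> 0" using assms(2) by simp
  ultimately show ?thesis using finite_nat_roots[of ?P] by presburger
qed

text \<open>Here the candidate root moves with \<open>p\<close>. The sum is \<open>p\<close> plus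
  terms \<open>c k * y ^ k * p ^ k\<close> with \<open>k > 0\<close>. Since
  \<open>d \<ge> 2\<close>, the extra \<open>p\<close> cannot cancel the top term in
  \<open>p ^ d\<close>, so the polynomial in \<open>p\<close> is nonzero.\<close>

lemma finite_constant_at_scaled_root:
  fixes c :: "nat \<Rightarrow> rat"
  assumes "d \<ge> 2" and "c d \<noteq> 0" and "y \<noteq> 0"
  shows "finite {p::nat. (\<Sum>k\<le>d. (c(0 := of_nat p)) k * (of_nat p * y) ^ k) = 0}"
proof -
  let ?P = "[:0, 1:] + (\<Sum>k\<in>{..d} - {0}. monom (c k * y ^ k) k)"
  have "(\<Sum>k\<le>d. (c(0 := of_nat p)) k * (of_nat p * y) ^ k) = poly ?P (of_nat p)" for p
    by (subst sum.remove[of _ 0])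
      (auto simp: poly_sum poly_monom power_mult_distrib mult_ac intro!: sum.cong)
  moreover have "coeff ?P d = c d * y ^ d"
    using assms(1) by (simp add: coeff_sum coeff_pCons split: nat.split)
  then have "?P \<noteq> 0" using assms(2,3) by (metis coeff_0 mult_eq_0_iff power_not_zero)
  ultimately show ?thesis using finite_nat_roots[of ?P] by presburger
qed

text \<open>For \<open>i < d\<close> the leading coefficient is fixed, so the denominators of
  possible roots range over a finite set. Only the numerators can depend on \<open>p\<close>, and
  only when \<open>i = 0\<close>.\<close>

lemma rootless_completion_below_top:
  fixes c :: "nat \<Rightarrow> rat"
  assumes d: "d \<ge> 2" and i: "i < d" and c0: "i \<noteq> 0 \<Longrightarrow> c 0 \<noteq> 0" and cd: "c d \<noteq> 0"
  shows "\<exists>p::nat. p \<noteq> 0 \<and> (\<forall>x. (\<Sum>k\<le>d. (c(i := of_nat p)) k * x ^ k) \<noteq> 0)"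
proof -
  obtain N b where N: "N > 0" and b: "\<And>k. k \<le> d \<Longrightarrow> of_int N * c k = of_int (b k)"
    using common_denominator[of d c] by blast
  have bd: "b d \<noteq> 0" and b0: "i \<noteq> 0 \<Longrightarrow> b 0 \<noteq> 0"
    using b[of d] b[of 0] N cd c0 by auto
  \<comment> \<open>Candidates independent of \<open>p\<close>: divisors of \<open>b 0\<close> serve
    \<open>i \<noteq> 0\<close>, divisors of \<open>N\<close> serve \<open>i = 0\<close>, where the
    cleared constant term is \<open>N * p\<close>. The guard on \<open>b 0\<close> keeps the set
    finite, as every integer divides 0.\<close>
  let ?F = "(\<lambda>(u, v). of_int u / of_int v) ` (({u. u dvd N} \<union> {u. u dvd b 0 \<and> b 0 \<noteq> 0}) \<times> {v. v dvd b d})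
    :: rat set"
  let ?Z = "\<lambda>(p::nat) x. (\<Sum>k\<le>d. (c(i := of_nat p)) k * x ^ k) = 0"
  \<comment> \<open>The bad values of \<open>p\<close>: some nonzero candidate \<open>y\<close>, or
    \<open>p * y\<close> if the constant term is being chosen, is a root.\<close>
  let ?B = "(\<Union>y\<in>?F - {0}. {p. ?Z p y}) \<union>
    (if i = 0 then \<Union>y\<in>?F - {0}. {p. ?Z p (of_nat p * y)} else {})"
  have fin_dvd: "finite {u. u dvd m}" if "m \<noteq> 0" for m :: int
    using that by (rule finite_divisors_int)
  have F: "finite ?F"
    using fin_dvd[of N] fin_dvd[of "b d"] fin_dvd[of "b 0"] N bd
    by (intro finite_imageI finite_cartesian_product finite_UnI) (auto intro: finite_subset)
  have "finite ?B"
  proof (intro finite_UnI)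
    show "finite (\<Union>y\<in>?F - {0}. {p. ?Z p y})"
      by (intro finite_UN_I finite_Diff F finite_constant_at_fixed_root) (use i in auto)
    show "finite (if i = 0 then \<Union>y\<in>?F - {0}. {p. ?Z p (of_nat p * y)} else {})"
    proof (cases "i = 0")
      case True
      have "finite (\<Union>y\<in>?F - {0}. {p. ?Z p (of_nat p * y)})"
        unfolding True
        by (intro finite_UN_I finite_Diff F finite_constant_at_scaled_root d cd) auto
      then show ?thesis using True by simp
    qed simp
  qed
  then have "\<not> {p. prime p} \<subseteq> ?B"
    using primes_infinite finite_subset by blast
  then obtain p where p: "prime p" and good: "p \<notin> ?B"
    by blast
  have "\<not> ?Z p x" for x
  proof
    assume Z: "?Z p x"
    obtain r s where rs: "s > 0" "coprime r s" and x: "x = of_int r / of_int s"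
      by (metis Fract_of_int_quotient Rat_cases)
    let ?b = "b(i := N * int p)"
    have b': "of_int N * (c(i := of_nat p)) k = of_int (?b k)" if "k \<le> d" for k
      using b[OF that] by simp
    have r: "r dvd ?b 0" and s: "s dvd ?b d"
      using rational_root_dvd[OF rs(2) _ b' Z[unfolded x]] rs(1) by blast+
    have sd: "s dvd b d" using s i by simp
    \<comment> \<open>The cleared constant term is nonzero, being \<open>b 0\<close> or
      \<open>N * p\<close>; a root 0 would have \<open>r = 0\<close> dividing it.\<close>
    have x0: "x \<noteq> 0"
    proof
      assume "x = 0"
      then have "?b 0 = 0" using r x rs(1) by simp
      then show False using b0 N p by (auto split: if_splits)
    qed
    \<comment> \<open>Either \<open>r\<close> divides \<open>b 0\<close> or \<open>N\<close>, and
      \<open>x\<close> itself is a candidate; or \<open>i = 0\<close> and \<open>r\<close> divides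
      \<open>N * p\<close> but not \<open>N\<close>. Then the prime \<open>p\<close> divides
      \<open>r\<close>, and \<open>x\<close> is \<open>p\<close> times a candidate.\<close>
    show False
    proof (cases "i \<noteq> 0 \<or> r dvd N")
      case True
      then have "x \<in> ?F"
        unfolding x using r sd b0 by (intro image_eqI[of _ _ "(r, s)"]) auto
      then show False using good x0 Z by blast
    next
      case False
      then have i0: "i = 0" and rN: "\<not> r dvd N" by auto
      have rNp: "r dvd N * int p" using r i0 by simp
      have "int p dvd r"
      proof (rule ccontr)
        assume "\<not> int p dvd r"
        then have "coprime r (int p)"
          using p by (metis coprime_commute prime_imp_coprime prime_nat_int_transfer)
        then show False using rNp rN by (simp add: coprime_dvd_mult_left_iff)
      qed
      then obtain u where u: "r = int p * u" by (elim dvdE)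
      have "u dvd N" using rNp p unfolding u by (simp add: mult.commute prime_gt_0_nat)
      then have "of_int u / of_int s \<in> ?F"
        using sd by (intro image_eqI[of _ _ "(u, s)"]) auto
      moreover have xu: "x = of_nat p * (of_int u / of_int s)" using x u by simp
      then have "of_int u / of_int s \<noteq> (0 :: rat)" using x0 by (metis mult_zero_right)
      ultimately have "of_int u / of_int s \<in> ?F - {0}" by blast
      moreover have "?Z p (of_nat p * (of_int u / of_int s))" using Z unfolding xu .
      ultimately have "p \<in> (\<Union>y\<in>?F - {0}. {p. ?Z p (of_nat p * y)})"
        by (intro UN_I[of "of_int u / of_int s"] CollectI)
      then show False using good i0 by (simp only: if_True UnI2 simp_thms)
    qed
  qed
  moreover have "p \<noteq> 0" using p by auto
  ultimately show ?thesis by blast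
qed

text \<open>The reciprocal polynomial evaluated at \<open>1 / x\<close>. This transfers the choice
  of the leading coefficient to the choice of the constant term.\<close>

lemma sum_reverse_inverse:
  fixes x :: "'a::field"
  assumes "x \<noteq> 0"
  shows "(\<Sum>k\<le>d. c (d - k) * inverse x ^ k) = (\<Sum>k\<le>d. c k * x ^ k) / x ^ d"
proof -
  have "(\<Sum>k\<le>d. c (d - k) * inverse x ^ k) = (\<Sum>k\<le>d. c k * inverse x ^ (d - k))"
    by (rule sum_atMost_reverse[of "\<lambda>j k. c j * inverse x ^ k"])
  also have "\<dots> = (\<Sum>k\<le>d. c k * x ^ k / x ^ d)"
  proof (rule sum.cong[OF refl])
    fix k assume "k \<in> {..d}"
    then have "x ^ d = x ^ (d - k) * x ^ k" by (simp flip: power_add)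
    then show "c k * inverse x ^ (d - k) = c k * x ^ k / x ^ d"
      using assms by (simp add: field_simps)
  qed
  finally show ?thesis by (simp add: sum_divide_distrib)
qed

lemma sum_fun_upd_reverse:
  "(\<Sum>k\<le>d. (c(d := a)) (d - k) * x ^ k) = (\<Sum>k\<le>(d::nat). ((\<lambda>k. c (d - k))(0 := a)) k * x ^ k)"
  by (rule sum.cong) auto

lemma rootless_completion:
  fixes c :: "nat \<Rightarrow> rat"
  assumes d: "d \<ge> 2" and i: "i \<le> d" and c0: "i \<noteq> 0 \<Longrightarrow> c 0 \<noteq> 0" and cd: "i \<noteq> d \<Longrightarrow> c d \<noteq> 0"
  shows "\<exists>p::nat. p \<noteq> 0 \<and> (\<forall>x. (\<Sum>k\<le>d. (c(i := of_nat p)) k * x ^ k) \<noteq> 0)"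
proof (cases "i = d")
  case False
  then show ?thesis using rootless_completion_below_top[of d i c] assms by simp
next
  case True
  obtain p :: nat where p: "p \<noteq> 0"
    and rev: "\<And>x. (\<Sum>k\<le>d. ((\<lambda>k. c (d - k))(0 := of_nat p)) k * x ^ k) \<noteq> 0"
    \<comment> \<open>The leading coefficient of the reversed polynomial is \<open>c 0\<close>,
      nonzero because \<open>i = d \<noteq> 0\<close>.\<close>
    using rootless_completion_below_top[of d 0 "\<lambda>k. c (d - k)"] d c0 True by auto
  have "(\<Sum>k\<le>d. (c(d := of_nat p)) k * x ^ k) \<noteq> 0" for x
  \<comment> \<open>Reversal says nothing about the point 0, but there the value is the constant
    term \<open>c 0\<close>.\<close>
  proof (cases "x = 0")
    case True
    have "(\<Sum>k\<le>d. (c(d := of_nat p)) k * 0 ^ k) = c 0"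
      using d by (subst sum.remove[of _ 0]) (auto intro!: sum.neutral)
    then show ?thesis using True c0 \<open>i = d\<close> d by simp
  next
    case False
    have "(\<Sum>k\<le>d. (c(d := of_nat p)) (d - k) * inverse x ^ k) \<noteq> 0"
      unfolding sum_fun_upd_reverse by (rule rev)
    then show ?thesis using sum_reverse_inverse[OF False, of "c(d := of_nat p)" d] by auto
  qed
  then show ?thesis using p True by blast
qed

section \<open>Wanda's last move: forcing a root\<close>

lemma is_subring_power: "is_subring D \<Longrightarrow> x \<in> D \<Longrightarrow> x ^ n \<in> D"
  by (induction n) (auto simp: is_subring_def)

lemma is_subring_sum:
  assumes "is_subring D" and "\<And>k. k \<in> A \<Longrightarrow> f k \<in> D"
  shows "sum f A \<in> D"
  using assms(2)
  by (induction A rule: infinite_finite_induct) (use assms(1) in \<open>auto simp: is_subring_def\<close>)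

text \<open>Prescribe a natural number \<open>n\<close> as root and solve for the constant term,
  which lies in \<open>D\<close> because \<open>n\<close> does. It is nonzero if \<open>n\<close>
  avoids the finitely many roots of the other terms. A nonzero root is required so that it can be
  inverted when the polynomial is reversed.\<close>

lemma rooted_completion_constant:
  fixes c :: "nat \<Rightarrow> rat"
  assumes D: "is_subring D" "\<int> \<subseteq> D" and d: "d \<ge> 1" and c: "\<And>k. k \<le> d \<Longrightarrow> c k \<in> D" and cd: "c d \<noteq> 0"
  shows "\<exists>a\<in>D. a \<noteq> 0 \<and> (\<exists>x. x \<noteq> 0 \<and> (\<Sum>k\<le>d. (c(0 := a)) k * x ^ k) = 0)"
proof -
  let ?P = "\<Sum>k\<in>{..d} - {0}. monom (c k) k"
  have "coeff ?P d = c d" using d by (simp add: coeff_sum)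
  then have "finite {n::nat. poly ?P (of_nat n) = 0}"
    using cd by (intro finite_nat_roots) (metis coeff_0)
  \<comment> \<open>Inserting 0 excludes it as the prescribed root.\<close>
  then have "finite (insert 0 {n::nat. poly ?P (of_nat n) = 0})" by simp
  then obtain n where n: "n \<noteq> 0" "poly ?P (of_nat n) \<noteq> 0"
    using ex_new_if_finite[OF infinite_UNIV_nat] by auto
  let ?a = "- poly ?P (of_nat n)"
  have "poly ?P (of_nat n) = (\<Sum>k\<in>{..d} - {0}. c k * of_nat n ^ k)"
    by (simp add: poly_sum poly_monom)
  moreover have "\<dots> \<in> D"
  proof (rule is_subring_sum[OF D(1)])
    fix k assume "k \<in> {..d} - {0}"
    moreover have "of_nat n ^ k \<in> D" using D by (intro is_subring_power) auto
    ultimately show "c k * of_nat n ^ k \<in> D" using c D(1) by (simp add: is_subring_def)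
  qed
  ultimately have "?a \<in> D" using D(1) by (simp add: is_subring_def)
  moreover have "(\<Sum>k\<le>d. (c(0 := ?a)) k * of_nat n ^ k) = 0"
    by (subst sum.remove[of _ 0]) (auto simp: poly_sum poly_monom)
  ultimately show ?thesis
    using n by (intro bexI[of _ ?a] conjI exI[of _ "of_nat n"]) auto
qed

lemma rooted_completion:
  fixes c :: "nat \<Rightarrow> rat"
  assumes D: "is_subring D" "\<int> \<subseteq> D" and d: "d \<ge> 1" and i: "i \<le> d"
    and c: "\<And>k. k \<le> d \<Longrightarrow> c k \<in> D" and c0: "i \<noteq> 0 \<Longrightarrow> c 0 \<noteq> 0" and cd: "i \<noteq> d \<Longrightarrow> c d \<noteq> 0"
  shows "\<exists>a\<in>D. (i = 0 \<or> i = d \<longrightarrow> a \<noteq> 0) \<and> (\<exists>x. (\<Sum>k\<le>d. (c(i := a)) k * x ^ k) = 0)"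
proof -
  consider "i = 0" | "i = d" | "i \<noteq> 0" "i \<noteq> d" by blast
  then show ?thesis
  proof cases
    case 1
    then have "c d \<noteq> 0" using cd d by simp
    then show ?thesis using rooted_completion_constant[of D d c, OF D d c] 1 by blast
  next
    case 2
    \<comment> \<open>Choose the constant term of the reversed polynomial; the inverse of its root
      is then a root of the original.\<close>
    have "\<exists>a\<in>D. a \<noteq> 0 \<and> (\<exists>x. x \<noteq> 0 \<and> (\<Sum>k\<le>d. ((\<lambda>k. c (d - k))(0 := a)) k * x ^ k) = 0)"
      using rooted_completion_constant[OF D d, of "\<lambda>k. c (d - k)"] c c0 2 d by auto
    then obtain a x where a: "a \<in> D" "a \<noteq> 0" "x \<noteq> 0"
      and x: "(\<Sum>k\<le>d. ((\<lambda>k. c (d - k))(0 := a)) k * x ^ k) = 0" by blast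
    have "(\<Sum>k\<le>d. (c(d := a)) (d - k) * x ^ k) = 0"
      unfolding sum_fun_upd_reverse by (rule x)
    then have "(\<Sum>k\<le>d. (c(d := a)) k * inverse x ^ k) = 0"
      using sum_reverse_inverse[of "inverse x" "c(d := a)" d] a by auto
    then show ?thesis using a 2 by blast
  next
    case 3
    \<comment> \<open>An inner coefficient may be 0, so it can simply be solved for with root
      1.\<close>
    let ?a = "- (\<Sum>k\<in>{..d} - {i}. c k)"
    have "?a \<in> D" using is_subring_sum[OF D(1), of "{..d} - {i}" c] c D(1)
      by (auto simp: is_subring_def)
    moreover have "(\<Sum>k\<le>d. (c(i := ?a)) k * 1 ^ k) = 0"
      using i by (subst sum.remove[of _ i]) auto
    ultimately show ?thesis using 3 by blast
  qed
qed

section \<open>Legal positions, their polynomials, and reduction to the last move\<close>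

lemma legal_position_snoc:
  "legal_position D d (h @ [m]) \<longleftrightarrow> legal_position D d h \<and> legal_move D d h m"
  by (auto simp: legal_position_def less_Suc_eq nth_append)

lemma play_poly_snoc: "play_poly (h @ [(i, a)]) = play_poly h + monom a i"
  by (simp add: play_poly_def)

lemma distinct_indices:
  "legal_position D d h \<Longrightarrow> distinct (map fst h) \<and> fst ` set h \<subseteq> {..d}"
  by (induction h rule: rev_induct)
    (auto simp: legal_position_snoc legal_move_def split: prod.splits)

lemma coeff_play_poly:
  assumes "is_subring D" and "legal_position D d h"
  shows "coeff (play_poly h) k \<in> D"
    and "k \<notin> fst ` set h \<Longrightarrow> coeff (play_poly h) k = 0"
    and "k \<in> fst ` set h \<Longrightarrow> k = 0 \<or> k = d \<Longrightarrow> coeff (play_poly h) k \<noteq> 0"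
proof -
  \<comment> \<open>The claims are proved jointly: a new move adds its value to the old coefficient
    at a fresh index, and nonvanishing there needs that old coefficient to be 0.\<close>
  have "coeff (play_poly h) k \<in> D \<and> (k \<notin> fst ` set h \<longrightarrow> coeff (play_poly h) k = 0) \<and>
    (k \<in> fst ` set h \<longrightarrow> k = 0 \<or> k = d \<longrightarrow> coeff (play_poly h) k \<noteq> 0)"
    using assms(2)
  proof (induction h rule: rev_induct)
    case Nil
    then show ?case using assms(1) by (simp add: play_poly_def is_subring_def)
  next
    case (snoc m h)
    obtain i a where m: "m = (i, a)" by (cases m)
    show ?case
      using snoc assms(1)
      by (cases "k = i")
        (auto simp: m play_poly_snoc legal_position_snoc legal_move_def is_subring_def)
  qed
  then show "coeff (play_poly h) k \<in> D"
    and "k \<notin> fst ` set h \<Longrightarrow> coeff (play_poly h) k = 0"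
    and "k \<in> fst ` set h \<Longrightarrow> k = 0 \<or> k = d \<Longrightarrow> coeff (play_poly h) k \<noteq> 0"
    by blast+
qed

lemma ex_unused_index:
  assumes "length h < d + 1"
  shows "\<exists>i\<le>d. i \<notin> fst ` set h"
proof (rule ccontr)
  assume "\<not> ?thesis"
  then have "{..d} \<subseteq> fst ` set h" by auto
  then have "card {..d} \<le> card (fst ` set h)" by (intro card_mono) auto
  also have "\<dots> \<le> length h" by (metis card_length length_map set_map)
  finally show False using assms by simp
qed

lemma last_index:
  assumes "legal_position D d h" and "length h = d"
  obtains i where "i \<le> d" and "fst ` set h = {..d} - {i}"
proof -
  obtain i where i: "i \<le> d" "i \<notin> fst ` set h" using ex_unused_index[of h d] assms(2) by auto
  have "card (fst ` set h) = d"
    using distinct_indices[OF assms(1)] assms(2) by (metis distinct_card length_map set_map)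
  then have "fst ` set h = {..d} - {i}"
    using i distinct_indices[OF assms(1)] by (intro card_subset_eq) auto
  then show thesis using that i by blast
qed

text \<open>The strategy plays any legal move until move number \<open>d\<close> and a winning one
  then; no earlier position has to be controlled.\<close>

lemma winning_strategy_by_last_move:
  assumes D: "is_subring D"
    and win: "\<And>h. legal_position D d h \<Longrightarrow> length h = d \<Longrightarrow>
      \<exists>m. legal_move D d h m \<and> wins_play D (h @ [m]) (last_player pI d)"
  shows "has_winning_strategy D d pI (last_player pI d)"
proof -
  let ?p = "last_player pI d"
  let ?good = "\<lambda>h m. legal_move D d h m \<and> (length h = d \<longrightarrow> wins_play D (h @ [m]) ?p)"
  define \<sigma> where "\<sigma> h = (SOME m. ?good h m)" for h
  have \<sigma>: "?good h (\<sigma> h)" if h: "legal_position D d h" "length h < d + 1" for h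
  proof -
    obtain i where "i \<le> d" "i \<notin> fst ` set h" using ex_unused_index[OF h(2)] by blast
    \<comment> \<open>The value 1 is legal at every free index, including 0 and \<open>d\<close>,
      where 0 is forbidden.\<close>
    then have "legal_move D d h (i, 1)"
      using D by (simp add: legal_move_def is_subring_def)
    then have "\<exists>m. ?good h m" using win[OF h(1)] by blast
    then show ?thesis unfolding \<sigma>_def by (rule someI_ex)
  qed
  have "strategy D d pI ?p \<sigma>" using \<sigma> by (simp add: strategy_def)
  moreover have "wins_play D h ?p" if h: "complete_play D d h" "follows pI ?p \<sigma> h" for h
  proof -
    have len: "length h = Suc d" and leg: "legal_position D d h"
      using h(1) by (auto simp: complete_play_def)
    have split: "h = take d h @ [h ! d]"
      using len by (metis lessI order_refl take_Suc_conv_app_nth take_all)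
    have "h ! d = \<sigma> (take d h)"
      using h(2) len by (simp add: follows_def last_player_def)
    moreover have "legal_position D d (take d h)"
      using leg split legal_position_snoc by metis
    ultimately show ?thesis using \<sigma>[of "take d h"] len split by auto
  qed
  ultimately show ?thesis unfolding has_winning_strategy_def by blast
qed

text \<open>The coefficient at the free index \<open>i\<close> was 0, so adding the last monomial
  amounts to overwriting it. No index above \<open>d\<close> is ever played, so the sum up to
  \<open>d\<close> is the whole polynomial.\<close>

lemma poly_completed_play:
  assumes D: "is_subring D" and h: "legal_position D d h"
    and i: "i \<le> d" "fst ` set h = {..d} - {i}"
  shows "poly (play_poly (h @ [(i, a)])) x = (\<Sum>k\<le>d. ((coeff (play_poly h))(i := a)) k * x ^ k)"
proof -
  let ?f = "play_poly (h @ [(i, a)])"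
  have co: "coeff ?f = (coeff (play_poly h))(i := a)"
    using coeff_play_poly(2)[OF D h, of i] i(2) by (auto simp: play_poly_snoc)
  have "coeff ?f k = 0" if "k > d" for k
    using coeff_play_poly(2)[OF D h, of k] i that by (simp add: co)
  then have "degree ?f \<le> d" by (intro degree_le) auto
  then have "poly ?f x = (\<Sum>k\<le>d. coeff ?f k * x ^ k)"
    unfolding poly_altdef by (intro sum.mono_neutral_left) (auto simp: coeff_eq_0)
  then show ?thesis by (simp only: co)
qed

text \<open>Quotients of integers already exhaust the rationals, so winning depends only on whether
  there is a rational root.\<close>

lemma fraction_field_rat:
  fixes D :: "rat set"
  assumes "\<int> \<subseteq> D"
  shows "fraction_field D = UNIV"
proof -
  have "x \<in> fraction_field D" for x
  proof -
    obtain u v where "v > 0" "x = of_int u / of_int v"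
      by (metis Fract_of_int_quotient Rat_cases)
    then show ?thesis
      unfolding fraction_field_def
      by (intro CollectI exI[of _ "of_int u"] exI[of _ "of_int v"]) (use assms in auto)
  qed
  then show ?thesis by blast
qed

theorem theorem4p1:
  fixes D :: "rat set" and d :: nat and pI :: player
  assumes "is_subring D" and "\<int> \<subseteq> D" and "d \<ge> 2"
  shows "has_winning_strategy D d pI (last_player pI d)"
proof (rule winning_strategy_by_last_move[OF assms(1)])
  fix h assume h: "legal_position D d h" and len: "length h = d"
  obtain i where i: "i \<le> d" "fst ` set h = {..d} - {i}" using last_index[OF h len] .
  note coeffs = coeff_play_poly[OF assms(1) h]
  note eval_f = poly_completed_play[OF assms(1) h i]
  let ?c = "coeff (play_poly h)"
  \<comment> \<open>An end coefficient other than the missing one has already been played, hence is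
    nonzero by the rules.\<close>
  have c0: "i \<noteq> 0 \<Longrightarrow> ?c 0 \<noteq> 0" and cd: "i \<noteq> d \<Longrightarrow> ?c d \<noteq> 0"
    using coeffs(3) i by auto
  show "\<exists>m. legal_move D d h m \<and> wins_play D (h @ [m]) (last_player pI d)"
  proof (cases "last_player pI d")
    case Wanda
    obtain a where "a \<in> D" "i = 0 \<or> i = d \<longrightarrow> a \<noteq> 0"
      and "\<exists>x. (\<Sum>k\<le>d. (?c(i := a)) k * x ^ k) = 0"
      using rooted_completion[OF assms(1,2) _ i(1) coeffs(1) c0 cd] assms(3) by auto
    then show ?thesis
      using i Wanda by (intro exI[of _ "(i, a)"])
        (simp add: legal_move_def fraction_field_rat[OF assms(2)] eval_f)
  next
    case Nora
    obtain p :: nat where "p \<noteq> 0" and "\<forall>x. (\<Sum>k\<le>d. (?c(i := of_nat p)) k * x ^ k) \<noteq> 0"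
      using rootless_completion[OF assms(3) i(1) c0 cd] by blast
    moreover have "of_nat p \<in> D" using assms(2) by auto
    ultimately show ?thesis
      using i Nora by (intro exI[of _ "(i, of_nat p)"])
        (simp add: legal_move_def fraction_field_rat[OF assms(2)] eval_f)
  qed
qed

end
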